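(* Let $\Omega=\{(p,q)\in\mathbb{R}^2: p\ge0\text{ or }3q\le p\le0\}$, and let $p,q_1,q_2\in\mathbb{R}$ with $(p,q_1),(p,q_2)\in\Omega$. Consider the double inequality $$\left(\left(1-\tfrac{p}{3q_1}\right)a^{q_1}+\tfrac{p}{3q_1}b^{q_1}\right)^{1/p}a^{1-q_1/p}<SB(b,a)<\left(\left(1-\tfrac{p}{3q_2}\right)a^{q_2}+\tfrac{p}{3q_2}b^{q_2}\right)^{1/p}a^{1-q_2/p}\qquad(\ast)$$ for all $b>a>0$. (i) When $p\in[46/35,\infty)$, $(\ast)$ holds for all $b>a>0$ if and only if $q_1\le p/3+8/15$ and $q_2\ge p$. (ii) When $p\in[4/5,46/35)$, the left-hand inequality in $(\ast)$ holds for all $b>a>0$ whenever $q_1\le17p/23$, and the right-hand inequality holds for all $b>a>0$ if and only if $q_2\ge p$. (iii) When $p\in(0,4/5)$, the left-hand inequality in $(\ast)$ holds for all $b>a>0$ whenever $q_1\le17p/23$, and the right-hand inequality holds for all $b>a>0$ if and only if $q_2\ge p/3+8/15$. (iv) When $p\in(-\infty,0]$, $(\ast)$ holds for all $b>a>0$ if and only if $q_1\le p$ and $q_2\ge p/3+8/15$.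
   Context: For $b>a>0$, $SB(b,a)=\dfrac{\sqrt{b^2-a^2}}{\operatorname{arccosh}(b/a)}$ is the Schwab–Borchardt mean. Convention: for zero parameters, the expression $\left(\left(1-\frac{p}{3q}\right)a^q+\frac{p}{3q}b^q\right)^{1/p}a^{1-q/p}$ is understood as the corresponding limit: with $t=b/a$ it means $a\exp\frac{t^q-1}{3q}$ if $p=0$, $q\ne0$; $a\left(\frac p3\ln t+1\right)^{1/p}$ if $p>0$, $q=0$; and $a\,t^{1/3}$ if $p=q=0$. *)

theory Defs
  imports "HOL-Analysis.Analysis"
begin

definition SB :: "real \<Rightarrow> real \<Rightarrow> real" where
  "SB b a = sqrt (b\<^sup>2 - a\<^sup>2) / arcosh (b / a)"

definition Omega :: "(real \<times> real) set" where
  "Omega = {(p, q). p \<ge> 0 \<or> (3 * q \<le> p \<and> p \<le> 0)}"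

text \<open>
  The last three branches are the limits of the first expression as the vanishing
  parameters tend to zero. For \<open>(p, q)\<close> in \<open>Omega\<close> and \<open>b > a > 0\<close> every base raised
  to a real power below is positive, so \<open>powr\<close> is the usual power there. Points with
  \<open>q = 0\<close> and \<open>p < 0\<close> lie outside \<open>Omega\<close>; the value given to them by the third branch
  is irrelevant.
\<close>
definition M :: "real \<Rightarrow> real \<Rightarrow> real \<Rightarrow> real \<Rightarrow> real" where
  "M p q a b =
    (if p \<noteq> 0 \<and> q \<noteq> 0 then
       ((1 - p / (3 * q)) * a powr q + p / (3 * q) * b powr q) powr (1 / p) * a powr (1 - q / p)
     else if q \<noteq> 0 then
       a * exp (((b / a) powr q - 1) / (3 * q))
     else if p \<noteq> 0 then
       a * (p / 3 * ln (b / a) + 1) powr (1 / p)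
     else
       a * (b / a) powr (1 / 3))"

end

theory Submission
  imports Defs "HOL-Real_Asymp.Real_Asymp"
begin

text \<open>
  With \<open>b / a = cosh x\<close> one has \<open>SB b a = a * sinhc x\<close>, where \<open>sinhc x = sinh x / x\<close>. Writing
  \<open>L p y = (y powr p - 1) / p\<close> (and \<open>L 0 = ln\<close>; this is \<open>box_cox\<close> below),
  comparing \<open>M p q a b\<close> with \<open>SB b a\<close> amounts, in all branches at once, to comparing \<open>L q (cosh x)\<close> with \<open>3 * L p (sinhc x)\<close>.

  Only two inequalities need to be proved by hand: the upper one for \<open>p = q = 4/5\<close> and the lower
  one for \<open>p = 46/35\<close>, \<open>q = 34/35\<close>. The sign of the derivative of the logarithm of the quotient of
  the derivatives of both sides is the sign of a combination of hyperbolic functions whose power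
  series has, in these two cases, coefficients of one sign. The other pairs follow by monotonicity.
  On the rays \<open>q = p\<close> and \<open>q = 17 p / 23\<close> the weight \<open>p / (3 q)\<close> is constant and \<open>M\<close> is a power
  mean raised to a fixed exponent, hence increasing in \<open>p\<close>; on the line \<open>q = p / 3 + 8 / 15\<close>,
  \<open>M\<close> is decreasing in \<open>p\<close>. Necessity is read off the behaviour for \<open>x\<close> tending to 0, where the
  difference \<open>3 * L p (sinhc x) - L q (cosh x)\<close> has leading term
  \<open>(p / 3 + 8 / 15 - q) / 8 * x ^ 4\<close>, and for \<open>x\<close> tending to infinity.
\<close>

subsection \<open>Box-Cox transforms\<close>

definition box_cox :: "real \<Rightarrow> real \<Rightarrow> real" where
  "box_cox p y = (if p = 0 then ln y else (y powr p - 1) / p)"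

lemma box_cox_1 [simp]: "box_cox p 1 = 0"
  by (simp add: box_cox_def)

lemma box_cox_has_real_derivative [derivative_intros]:
  assumes "(f has_real_derivative f') (at x)" "f x > 0"
  shows "((\<lambda>x. box_cox p (f x)) has_real_derivative f x powr (p - 1) * f') (at x)"
proof -
  have "(box_cox p has_real_derivative y powr (p - 1)) (at y)" if "y > 0" for y
    unfolding box_cox_def using that
    by (cases "p = 0") (auto intro!: derivative_eq_intros simp: powr_minus field_simps)
  from DERIV_chain2[OF this[OF assms(2)] assms(1)] show ?thesis .
qed

lemma box_cox_strict_mono:
  assumes "0 < x" "x < y" shows "box_cox p x < box_cox p y"
  using assms(2)
proof (rule DERIV_pos_imp_increasing)
  fix z assume "x \<le> z" "z \<le> y"
  with assms have "z > 0" by simp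
  then show "\<exists>D. (box_cox p has_real_derivative D) (at z) \<and> D > 0"
    by (intro exI[of _ "z powr (p - 1)"] conjI) (auto intro!: derivative_eq_intros)
qed

lemma box_cox_less_iff:
  assumes "0 < x" "0 < y" shows "box_cox p x < box_cox p y \<longleftrightarrow> x < y"
  using box_cox_strict_mono[of x y p] box_cox_strict_mono[of y x p] assms
  by (cases x y rule: linorder_cases) auto

lemma box_cox_mono_exponent:
  assumes "p \<le> q" "1 \<le> y" shows "box_cox p y \<le> box_cox q y"
proof -
  have "box_cox q 1 - box_cox p 1 \<le> box_cox q y - box_cox p y"
    using assms(2)
  proof (rule DERIV_nonneg_imp_nondecreasing)
    fix z assume "1 \<le> z" "z \<le> y"
    then show "\<exists>D. ((\<lambda>z. box_cox q z - box_cox p z) has_real_derivative D) (at z) \<and> D \<ge> 0"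
      using assms
      by (intro exI[of _ "z powr (q - 1) - z powr (p - 1)"] conjI)
        (auto intro!: derivative_eq_intros powr_mono)
  qed
  then show ?thesis by simp
qed

definition sinhc :: "real \<Rightarrow> real" where
  "sinhc x = sinh x / x"

subsection \<open>The two extremal inequalities\<close>

lemma cosh_series_even: "(\<lambda>n. k^(2*n) * x^(2*n) / fact (2*n)) sums cosh (k * x :: real)"
proof -
  have "(\<lambda>n. if even n then (k*x) ^ n /\<^sub>R fact n else 0) sums cosh (k*x)"
    by (rule cosh_converges)
  then have "(\<lambda>n. (if even (2*n) then (k*x) ^ (2*n) /\<^sub>R fact (2*n) else 0)) sums cosh (k*x)"
    by (subst sums_mono_reindex[of "\<lambda>n. 2*n"]) (auto simp: strict_mono_def elim!: evenE)
  then show ?thesis by (simp add: power_mult_distrib field_simps)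
qed

lemma sinh_series_odd:
  "(\<lambda>n. k^(2*n+1) * x^(2*n+1) / fact (2*n+1)) sums sinh (k * x :: real)"
proof -
  have "(\<lambda>n. if even n then 0 else (k*x) ^ n /\<^sub>R fact n) sums sinh (k*x)"
    by (rule sinh_converges)
  then have "(\<lambda>n. (if even (2*n+1) then 0 else (k*x) ^ (2*n+1) /\<^sub>R fact (2*n+1))) sums sinh (k*x)"
    by (subst sums_mono_reindex[of "\<lambda>n. 2*n+1"]) (auto simp: strict_mono_def elim!: oddE)
  then show ?thesis by (simp add: power_mult_distrib field_simps)
qed

lemma x2_cosh_series:
  fixes k x :: real
  assumes "k \<noteq> 0"
  shows "(\<lambda>n. (real (2*n) * (real (2*n) - 1) * k^(2*n) / k\<^sup>2) * (x^(2*n) / fact (2*n)))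
    sums (x\<^sup>2 * cosh (k * x))"
proof -
  have "(\<lambda>n. x\<^sup>2 * (k^(2*n) * x^(2*n) / fact (2*n))) sums (x\<^sup>2 * cosh (k*x))"
    by (rule sums_mult[OF cosh_series_even])
  also have "(\<lambda>n. x\<^sup>2 * (k^(2*n) * x^(2*n) / fact (2*n)))
     = (\<lambda>n. real (2*Suc n) * (real (2*Suc n) - 1) * k^(2*Suc n) / k\<^sup>2 * (x^(2*Suc n) / fact (2*Suc n)))"
  proof
    fix n
    define a where "a = real (2*Suc n) * (real (2*Suc n) - 1)"
    have "a \<noteq> 0" and fact: "fact (2*Suc n) = a * (fact (2*n) :: real)"
      by (auto simp: a_def)
    have power: "y ^ (2*Suc n) = y ^ (2*n) * y\<^sup>2" for y :: real
      by (simp add: power2_eq_square)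
    show "x\<^sup>2 * (k^(2*n) * x^(2*n) / fact (2*n))
        = real (2*Suc n) * (real (2*Suc n) - 1) * k^(2*Suc n) / k\<^sup>2 * (x^(2*Suc n) / fact (2*Suc n))"
      unfolding a_def[symmetric] fact power using assms \<open>a \<noteq> 0\<close> by simp
  qed
  \<comment> \<open>The shifted series starts at index 1; the missing term is 0 because of the
    factor \<open>real (2*n)\<close>.\<close>
  finally show ?thesis
    by (subst (asm) sums_Suc_iff) simp
qed

lemma x_sinh_series:
  fixes k x :: real
  assumes "k \<noteq> 0"
  shows "(\<lambda>n. (real (2*n) * k^(2*n) / k) * (x^(2*n) / fact (2*n))) sums (x * sinh (k * x))"
proof -
  have "(\<lambda>n. x * (k^(2*n+1) * x^(2*n+1) / fact (2*n+1))) sums (x * sinh (k*x))"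
    by (rule sums_mult[OF sinh_series_odd])
  also have "(\<lambda>n. x * (k^(2*n+1) * x^(2*n+1) / fact (2*n+1)))
     = (\<lambda>n. real (2*Suc n) * k^(2*Suc n) / k * (x^(2*Suc n) / fact (2*Suc n)))"
  proof
    fix n
    define a where "a = real (2*Suc n)"
    have "a \<noteq> 0" "fact (2*Suc n) = a * (fact (2*n+1) :: real)"
      by (auto simp: a_def)
    moreover have "y ^ (2*Suc n) = y ^ (2*n+1) * y" for y :: real
      by simp
    ultimately show "x * (k^(2*n+1) * x^(2*n+1) / fact (2*n+1))
        = real (2*Suc n) * k^(2*Suc n) / k * (x^(2*Suc n) / fact (2*Suc n))"
      unfolding a_def[symmetric] using assms by simp
  qed
  finally show ?thesis
    by (subst (asm) sums_Suc_iff) simp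
qed

text \<open>
  The derivative of \<open>3 * box_cox p (sinhc x)\<close> divided by that of \<open>box_cox q (cosh x)\<close> has logarithmic
  derivative \<open>critical p q x\<close> over \<open>sinh x * cosh x * x * (x * cosh x - sinh x)\<close>.
\<close>
definition critical :: "real \<Rightarrow> real \<Rightarrow> real \<Rightarrow> real" where
  "critical p q x = x\<^sup>2 * ((p - q) * cosh x ^ 3 - (2 - q) * cosh x)
     + x * (sinh x * ((q - 2*p) * (cosh x)\<^sup>2 + 1 - q)) + (1 + p) * ((sinh x)\<^sup>2 * cosh x)"

text \<open>The powers of 9 are \<open>3^(2*n)\<close>, from the argument \<open>3 * x\<close>. For
  \<open>n\<close> up to 2 the value is 0 for all \<open>p\<close> and \<open>q\<close>; for
  \<open>n = 3\<close> it is \<open>960 * (p/3 + 8/15 - q)\<close>, so it vanishes exactly on the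
  line \<open>q = p/3 + 8/15\<close>.\<close>

definition critical_coeff :: "real \<Rightarrow> real \<Rightarrow> nat \<Rightarrow> real" where
  "critical_coeff p q n = (p - q) * (2 * real n) * (2 * real n - 1) * 9^n / 9
     + (3*p + q - 8) * (2 * real n) * (2 * real n - 1)
     + (q - 2*p) * (2 * real n) * 9^n / 3 + (4 - 3*q - 2*p) * (2 * real n) + (1 + p) * (9^n - 1)"

text \<open>Linearising the products to the arguments \<open>3 * x\<close> and \<open>x\<close>
  gives summands with explicit series; the 4 clears the denominators.\<close>

lemma critical_eq:
  "4 * critical p q x = (p - q) * (x\<^sup>2 * cosh (3 * x)) + (3*p + q - 8) * (x\<^sup>2 * cosh (1 * x))
     + (q - 2*p) * (x * sinh (3 * x)) + (4 - 3*q - 2*p) * (x * sinh (1 * x))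
     + (1 + p) * (cosh (3 * x) - cosh (1 * x))"
proof -
  have c3: "cosh (3*x) = 4 * cosh x ^ 3 - 3 * cosh x"
  proof -
    have "cosh (3*x) = cosh (2*x + x)" by simp
    also have "\<dots> = 4 * cosh x ^ 3 - 3 * cosh x"
      unfolding cosh_add cosh_double sinh_double using cosh_square_eq[of x] by algebra
    finally show ?thesis .
  qed
  have t3: "sinh (3*x) = 4 * (sinh x * (cosh x)\<^sup>2) - sinh x"
  proof -
    have "sinh (3*x) = sinh (2*x + x)" by simp
    also have "\<dots> = 4 * (sinh x * (cosh x)\<^sup>2) - sinh x"
      unfolding sinh_add cosh_double sinh_double using cosh_square_eq[of x] by algebra
    finally show ?thesis .
  qed
  have s2: "(sinh x)\<^sup>2 * cosh x = cosh x ^ 3 - cosh x"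
    using cosh_square_eq[of x] by (simp add: power3_eq_cube power2_eq_square algebra_simps)
  show ?thesis
    unfolding critical_def c3 t3 s2 mult_1 by algebra
qed

lemma critical_sums: "(\<lambda>n. critical_coeff p q n * (x^(2*n) / fact (2*n))) sums (4 * critical p q x)"
proof -
  have "(\<lambda>n. (p - q) * ((real (2*n) * (real (2*n) - 1) * 3^(2*n) / 3\<^sup>2) * (x^(2*n) / fact (2*n)))
     + (3*p + q - 8) * ((real (2*n) * (real (2*n) - 1) * 1^(2*n) / 1\<^sup>2) * (x^(2*n) / fact (2*n)))
     + (q - 2*p) * ((real (2*n) * 3^(2*n) / 3) * (x^(2*n) / fact (2*n)))
     + (4 - 3*q - 2*p) * ((real (2*n) * 1^(2*n) / 1) * (x^(2*n) / fact (2*n)))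
     + (1 + p) * (3^(2*n) * x^(2*n) / fact (2*n) - 1^(2*n) * x^(2*n) / fact (2*n))) sums
     (4 * critical p q x)"
    unfolding critical_eq
    by (intro sums_add sums_mult sums_diff cosh_series_even x2_cosh_series x_sinh_series) auto
  also have "(\<lambda>n. (p - q) * ((real (2*n) * (real (2*n) - 1) * 3^(2*n) / 3\<^sup>2) * (x^(2*n) / fact (2*n)))
     + (3*p + q - 8) * ((real (2*n) * (real (2*n) - 1) * 1^(2*n) / 1\<^sup>2) * (x^(2*n) / fact (2*n)))
     + (q - 2*p) * ((real (2*n) * 3^(2*n) / 3) * (x^(2*n) / fact (2*n)))
     + (4 - 3*q - 2*p) * ((real (2*n) * 1^(2*n) / 1) * (x^(2*n) / fact (2*n)))
     + (1 + p) * (3^(2*n) * x^(2*n) / fact (2*n) - 1^(2*n) * x^(2*n) / fact (2*n)))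
     = (\<lambda>n. critical_coeff p q n * (x^(2*n) / fact (2*n)))"
    by (rule ext) (simp add: critical_coeff_def power_mult add_divide_distrib diff_divide_distrib ring_distribs)
  finally show ?thesis .
qed

lemma critical_pos:
  assumes "\<And>n. e * critical_coeff p q n \<ge> 0" "e * critical_coeff p q m > 0" "x > 0"
  shows "e * critical p q x > 0"
proof -
  have S: "(\<lambda>n. e * critical_coeff p q n * (x^(2*n) / fact (2*n))) sums (e * (4 * critical p q x))"
    unfolding mult.assoc by (intro sums_mult critical_sums)
  have "0 < (\<Sum>n. e * critical_coeff p q n * (x^(2*n) / fact (2*n)))"
    using assms by (intro suminf_pos2[where i = m] sums_summable[OF S]) auto
  then show ?thesis using sums_unique[OF S] by simp
qed

text \<open>At \<open>p = q\<close> the part growing like \<open>n^2 * 9^n\<close> drops out. The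
  coefficients vanish up to \<open>n = 3\<close>; from \<open>n = 4\<close> on,
  \<open>81 - 24 * n\<close> is negative.\<close>

lemma critical_neg_45:
  assumes "x > 0" shows "critical (4/5) (4/5) x < 0"
proof -
  have coeff: "critical_coeff (4/5) (4/5) n
     = (9^n * (81 - 24 * real n) / 9 - 24 * (2 * n) * (2 * real n - 1) - 9) / 5" for n
    by (simp add: critical_coeff_def field_simps)
  have "-1 * critical_coeff (4/5) (4/5) n \<ge> 0" for n
  proof (cases "n \<ge> 4")
    case True
    then have "9^n * (81 - 24 * real n) \<le> 0" by (intro mult_nonneg_nonpos) auto
    moreover have "2 * real n * (2 * real n - 1) \<ge> 0" using True by simp
    ultimately show ?thesis by (simp add: coeff)
  next
    case False
    then have "n = 0 \<or> n = 1 \<or> n = 2 \<or> n = 3" by auto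
    then show ?thesis by (elim disjE) (simp_all add: coeff)
  qed
  then have "-1 * critical (4/5) (4/5) x > 0"
    by (rule critical_pos[OF _ _ assms, where m = 4]) (simp add: coeff)
  then show ?thesis by simp
qed

text \<open>This is the point of the line \<open>q = p/3 + 8/15\<close> where the coefficient for
  \<open>n = 4\<close> vanishes too; the first nonzero one is at \<open>n = 5\<close>.\<close>

lemma critical_pos_46_35:
  assumes "x > 0" shows "critical (46/35) (34/35) x > 0"
proof -
  have coeff: "critical_coeff (46/35) (34/35) n
     = (9^n * (48 * (real n)\<^sup>2 - 372 * n + 729) / 9 - 432 * (real n)\<^sup>2 + 108 * n - 81) / 35" for n
    by (simp add: critical_coeff_def field_simps power2_eq_square)
  have "1 * critical_coeff (46/35) (34/35) n \<ge> 0" for n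
  proof (cases "n \<ge> 5")
    case True
    define Q where "Q = 48 * (real n)\<^sup>2 - 372 * n + 729"
    \<comment> \<open>The product is \<open>Q - 69\<close>, and 69 is the value of \<open>Q\<close>
      at \<open>n = 5\<close>.\<close>
    have "(real n - 5) * (48 * real n - 132) \<ge> 0" using True by (intro mult_nonneg_nonneg) auto
    then have "Q \<ge> 69" by (simp add: Q_def algebra_simps power2_eq_square)
    moreover have "(9::real)^n \<ge> 9^5" using True by (intro power_increasing) auto
    ultimately have "9^5 * Q \<le> 9^n * Q" by (intro mult_right_mono) auto
    \<comment> \<open>With \<open>6561 = 9^5 / 9\<close>, the product is the difference of the sides
      of the next inequality minus a positive constant.\<close>
    moreover have "(real n - 5) * (314496 * real n - 868104) \<ge> 0"
      using True by (intro mult_nonneg_nonneg) auto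
    then have "6561 * Q \<ge> 432 * (real n)\<^sup>2 - 108 * n + 81"
      by (simp add: Q_def algebra_simps power2_eq_square)
    ultimately show ?thesis unfolding coeff Q_def[symmetric] by simp
  next
    case False
    then have "n = 0 \<or> n = 1 \<or> n = 2 \<or> n = 3 \<or> n = 4" by auto
    then show ?thesis by (elim disjE) (simp_all add: coeff power2_eq_square)
  qed
  then have "1 * critical (46/35) (34/35) x > 0"
    by (rule critical_pos[OF _ _ assms, where m = 5]) (simp add: coeff power2_eq_square)
  then show ?thesis by simp
qed

section \<open>From the sign of \<open>critical\<close> to the sign of the gap\<close>

lemma less_of_limit_at_right_0:
  fixes f f' :: "real \<Rightarrow> real"
  assumes lim: "(f \<longlongrightarrow> l) (at_right 0)" and "x > 0"
    and der: "\<And>x. x > 0 \<Longrightarrow> (f has_real_derivative f' x) (at x)" and pos: "\<And>x. x > 0 \<Longrightarrow> f' x > 0"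
  shows "l < f x"
proof -
  have mono: "f y < f z" if "0 < y" "y < z" for y z
    using that(2)
  proof (rule DERIV_pos_imp_increasing)
    fix t assume "y \<le> t" "t \<le> z"
    with that show "\<exists>D. (f has_real_derivative D) (at t) \<and> D > 0"
      by (intro exI[of _ "f' t"] conjI der pos) auto
  qed
  \<comment> \<open>Passing to the limit at \<open>x/2\<close> instead of \<open>x\<close> keeps the
    final inequality strict.\<close>
  have "eventually (\<lambda>y. f y \<le> f (x/2)) (at_right 0)"
    using mono \<open>x > 0\<close> by (auto simp: eventually_at_right_field intro!: exI[of _ "x/2"] less_imp_le)
  then have "l \<le> f (x/2)" using lim by (intro tendsto_upperbound) auto
  also have "\<dots> < f x" using \<open>x > 0\<close> by (intro mono) auto
  finally show ?thesis .
qed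

lemma sinhc_tendsto: "(sinhc \<longlongrightarrow> 1) (at_right 0)"
  unfolding sinhc_def by real_asymp

lemma cosh_gt_1: "x > 0 \<Longrightarrow> cosh x > (1::real)"
  using cosh_real_strict_mono[of 0 x] by simp

lemma x_cosh_minus_sinh_pos:
  assumes "x > 0" shows "x * cosh x - sinh x > (0::real)"
proof (rule less_of_limit_at_right_0[OF _ assms])
  show "((\<lambda>x. x * cosh x - sinh x) \<longlongrightarrow> 0) (at_right (0::real))" by real_asymp
  show "((\<lambda>x. x * cosh x - sinh x) has_real_derivative x * sinh x) (at x)" for x :: real
    by (auto intro!: derivative_eq_intros)
qed simp

lemma sinhc_gt_1: "x > 0 \<Longrightarrow> sinhc x > 1"
proof (rule less_of_limit_at_right_0[OF sinhc_tendsto])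
  fix x :: real assume "x > 0"
  then show "(sinhc has_real_derivative (x * cosh x - sinh x) / x\<^sup>2) (at x)"
    unfolding sinhc_def by (auto intro!: derivative_eq_intros simp: field_simps power2_eq_square)
  show "(x * cosh x - sinh x) / x\<^sup>2 > 0"
    using \<open>x > 0\<close> x_cosh_minus_sinh_pos[of x] by simp
qed

text \<open>\<open>R\<close> is the logarithm of the quotient of the derivatives of the two terms.
  It tends to 0 at 0 and its derivative has the sign of \<open>critical\<close>; hence
  \<open>R\<close>, then \<open>G'\<close>, then \<open>G\<close> inherit that sign. The factor
  \<open>e\<close> treats both signs at once.\<close>

lemma gap_sign:
  assumes e: "\<And>x. x > 0 \<Longrightarrow> e * critical p q x > 0" "e \<in> {1, -1}" and x: "x > 0"
  shows "e * (3 * box_cox p (sinhc x) - box_cox q (cosh x)) > 0"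
proof -
  define R where "R x = (p - 2) * (ln (sinh x) - ln x) + ln ((x * cosh x - sinh x) / x ^ 3)
    + (1 - q) * ln (cosh x) + ln 3" for x :: real
  define R' where "R' x = critical p q x / (sinh x * cosh x * x * (x * cosh x - sinh x))" for x
  have R_lim: "((\<lambda>x. e * R x) \<longlongrightarrow> e * ((p - 2) * 0 + ln (1/3) + (1 - q) * 0 + ln 3)) (at_right 0)"
    unfolding R_def
  proof (intro tendsto_add tendsto_mult_left tendsto_const)
    show "((\<lambda>x. ln (sinh x) - ln x) \<longlongrightarrow> 0) (at_right (0::real))" by real_asymp
    show "((\<lambda>x. ln ((x * cosh x - sinh x) / x ^ 3)) \<longlongrightarrow> ln (1/3)) (at_right (0::real))"
      by (rule tendsto_ln) (real_asymp, simp)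
    show "((\<lambda>x. ln (cosh x)) \<longlongrightarrow> 0) (at_right (0::real))" by real_asymp
  qed
  have R_pos: "e * R x > 0" if "x > 0" for x
  proof -
    have "e * ((p - 2) * 0 + ln (1/3) + (1 - q) * 0 + ln 3) < e * R x"
    proof (rule less_of_limit_at_right_0[OF R_lim that])
      fix x :: real assume x: "x > 0"
      note pos = x x_cosh_minus_sinh_pos[OF x] sinh_real_pos_iff[THEN iffD2, OF x] cosh_real_pos[of x]
      have "(R has_real_derivative R' x) (at x)"
        unfolding R_def R'_def using pos
        apply (auto intro!: derivative_eq_intros)
        apply (simp add: field_simps critical_def)
        using cosh_square_eq[of x] apply algebra
        done
      then show "((\<lambda>x. e * R x) has_real_derivative e * R' x) (at x)"
        by (auto intro!: derivative_eq_intros)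
      have "e * R' x = e * critical p q x / (sinh x * cosh x * x * (x * cosh x - sinh x))"
        by (simp add: R'_def)
      also have "\<dots> > 0" using pos by (intro divide_pos_pos[OF e(1)[OF x]] mult_pos_pos) auto
      finally show "e * R' x > 0" .
    qed
    then show ?thesis by (simp add: ln_div)
  qed
  define G where "G x = 3 * box_cox p (sinhc x) - box_cox q (cosh x)" for x
  define G' where "G' x = cosh x powr (q - 1) * sinh x * (exp (R x) - 1)" for x
  have "e * (3 * box_cox p 1 - box_cox q 1) < e * G x"
  proof (rule less_of_limit_at_right_0[OF _ x])
    have lims: "((\<lambda>x. box_cox r (f x)) \<longlongrightarrow> box_cox r 1) (at_right 0)"
      if "(f \<longlongrightarrow> 1) (at_right 0)" for r and f :: "real \<Rightarrow> real"
      using that by (cases "r = 0") (auto simp: box_cox_def intro!: tendsto_eq_intros)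
    have "(cosh \<longlongrightarrow> (1::real)) (at_right 0)" by real_asymp
    then show "((\<lambda>x. e * G x) \<longlongrightarrow> e * (3 * box_cox p 1 - box_cox q 1)) (at_right 0)"
      unfolding G_def by (intro tendsto_intros lims sinhc_tendsto)
    fix x :: real assume x: "x > 0"
    note pos = x x_cosh_minus_sinh_pos[OF x] sinh_real_pos_iff[THEN iffD2, OF x] cosh_real_pos[of x]
    have S: "sinhc x > 0" using pos by (simp add: sinhc_def)
    have "exp (R x) = (sinhc x) powr (p - 2) * ((x * cosh x - sinh x) / x ^ 3) * cosh x powr (1 - q) * 3"
    proof -
      have "ln (sinhc x) = ln (sinh x) - ln x"
        using pos by (simp add: sinhc_def ln_div)
      moreover have "(x * cosh x - sinh x) / x ^ 3 > 0"
        using pos by (intro divide_pos_pos) auto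
      ultimately show ?thesis
        using S pos by (simp only: R_def exp_add exp_ln powr_def) simp
    qed
    then have "cosh x powr (q - 1) * sinh x * exp (R x)
        = 3 * (sinhc x powr (p - 1) * ((x * cosh x - sinh x) / x\<^sup>2))"
    proof -
      have "cosh x powr (q - 1) * cosh x powr (1 - q) = 1"
        by (simp flip: powr_add)
      moreover have "sinhc x powr (p - 1) = sinhc x powr (p - 2) * sinhc x"
        using powr_add[of "sinhc x" "p - 2" 1] S by simp
      then have "sinh x * sinhc x powr (p - 2) = x * sinhc x powr (p - 1)"
        using x by (simp add: sinhc_def)
      moreover have "cosh x powr (q - 1) * sinh x * exp (R x)
        = (cosh x powr (q - 1) * cosh x powr (1 - q)) * (sinh x * sinhc x powr (p - 2))
          * (3 * ((x * cosh x - sinh x) / x ^ 3))"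
        unfolding \<open>exp (R x) = _\<close> by (simp only: mult_ac)
      ultimately show ?thesis
        using x by (simp add: power2_eq_square power3_eq_cube)
    qed
    moreover have "(sinhc has_real_derivative (x * cosh x - sinh x) / x\<^sup>2) (at x)"
      unfolding sinhc_def using x
      by (auto intro!: derivative_eq_intros simp: field_simps power2_eq_square)
    ultimately have "(G has_real_derivative G' x) (at x)"
      unfolding G_def G'_def using S
      by (auto intro!: derivative_eq_intros simp: algebra_simps)
    then show "((\<lambda>x. e * G x) has_real_derivative e * G' x) (at x)"
      by (auto intro!: derivative_eq_intros)
    have "e * (exp (R x) - 1) > 0"
      using R_pos[OF x] e(2) by auto
    then have "cosh x powr (q - 1) * sinh x * (e * (exp (R x) - 1)) > 0"
      using pos by (intro mult_pos_pos[OF mult_pos_pos]) auto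
    then show "e * G' x > 0" by (simp add: G'_def mult_ac)
  qed
  then show ?thesis by (simp add: G_def)
qed

text \<open>The line \<open>q = p/3 + 8/15\<close> meets the diagonal at \<open>(4/5, 4/5)\<close>
  and the ray \<open>q = 17 * p / 23\<close> at \<open>(46/35, 34/35)\<close>, so each of the two
  points starts two families.\<close>

lemma gap_45: "x > 0 \<Longrightarrow> 3 * box_cox (4/5) (sinhc x) < box_cox (4/5) (cosh x)"
  using gap_sign[of "-1" "4/5" "4/5" x] critical_neg_45 by simp

lemma gap_46_35: "x > 0 \<Longrightarrow> box_cox (34/35) (cosh x) < 3 * box_cox (46/35) (sinhc x)"
  using gap_sign[of 1 "46/35" "34/35" x] critical_pos_46_35 by simp

subsection \<open>Reduction of the double inequality\<close>

text \<open>Pulling \<open>a powr q\<close> out of the bracket leaves an expression in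
  \<open>b / a\<close> that covers all branches of \<open>M\<close>.\<close>

lemma M_eq:
  assumes "(p, q) \<in> Omega" "0 < a" "a < b"
  shows "1 + p * (box_cox q (b / a) / 3) > 0"
    and "M p q a b = a * (if p = 0 then exp (box_cox q (b / a) / 3)
      else (1 + p * (box_cox q (b / a) / 3)) powr (1 / p))"
proof -
  define t where "t = b / a"
  have t: "t > 1" "b = a * t" using assms by (auto simp: t_def)
  have bc: "box_cox q t > 0" using box_cox_strict_mono[of 1 t q] t by simp
  have base: "1 + p * (box_cox q t / 3) > 0"
  proof (cases "p \<ge> 0")
    case True
    then have "p * (box_cox q t / 3) \<ge> 0" using bc by simp
    then show ?thesis by linarith
  next
    case False
    \<comment> \<open>Here \<open>3 * q \<le> p < 0\<close>, so the base is a convex combination of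
      1 and \<open>t powr q\<close>.\<close>
    define w where "w = p / (3 * q)"
    have "w \<le> 1" "w > 0" "q \<noteq> 0" using False assms(1) by (auto simp: Omega_def w_def field_simps)
    then have "(1 - w) + w * t powr q > 0" using t by (intro add_nonneg_pos) auto
    also have "(1 - w) + w * t powr q = 1 + p * (box_cox q t / 3)"
      using \<open>q \<noteq> 0\<close> by (simp add: w_def box_cox_def field_simps)
    finally show ?thesis .
  qed
  then show "1 + p * (box_cox q (b / a) / 3) > 0" by (simp add: t_def)
  have "M p q a b = a * (if p = 0 then exp (box_cox q t / 3)
      else (1 + p * (box_cox q t / 3)) powr (1 / p))"
  proof (cases "p = 0 \<or> q = 0")
    case True
    then show ?thesis
      using t assms by (auto simp: M_def box_cox_def powr_def field_simps)
  next
    case False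
    have "(1 - p / (3 * q)) * a powr q + p / (3 * q) * b powr q = a powr q * (1 + p * (box_cox q t / 3))"
      using False t assms by (simp add: box_cox_def powr_mult field_simps)
    then have "M p q a b = (a powr q) powr (1 / p) * (1 + p * (box_cox q t / 3)) powr (1 / p) * a powr (1 - q / p)"
      using False base by (simp add: M_def powr_mult)
    also have "(a powr q) powr (1 / p) = a powr (q / p)"
      by (simp add: powr_powr)
    finally show ?thesis
      using False assms by (simp add: powr_diff)
  qed
  then show "M p q a b = a * (if p = 0 then exp (box_cox q (b / a) / 3)
      else (1 + p * (box_cox q (b / a) / 3)) powr (1 / p))" by (simp add: t_def)
qed

lemma box_cox_M:
  assumes "(p, q) \<in> Omega" "0 < a" "a < b"
  shows "M p q a b / a > 0" "box_cox p (M p q a b / a) = box_cox q (b / a) / 3"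
proof -
  show pos: "M p q a b / a > 0" using M_eq[OF assms] assms by simp
  show "box_cox p (M p q a b / a) = box_cox q (b / a) / 3"
  proof (cases "p = 0")
    case False
    have "((1 + p * (box_cox q (b / a) / 3)) powr (1 / p)) powr p = 1 + p * (box_cox q (b / a) / 3)"
      using M_eq(1)[OF assms] False by (simp add: powr_powr)
    then show ?thesis
      using False assms(2) unfolding M_eq(2)[OF assms] by (simp add: box_cox_def[of p])
  next
    case True
    then show ?thesis
      using assms(2) unfolding M_eq(2)[OF assms] by (simp add: box_cox_def[of 0])
  qed
qed

lemma SB_eq:
  assumes "0 < a" "a < b"
  shows "SB b a = a * sinhc (arcosh (b / a))"
proof -
  have "b\<^sup>2 - a\<^sup>2 = a\<^sup>2 * ((b / a)\<^sup>2 - 1)"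
    using assms by (simp add: field_simps)
  then have "sqrt (b\<^sup>2 - a\<^sup>2) = a * sinh (arcosh (b / a))"
    using assms by (simp add: sinh_arcosh_real real_sqrt_mult)
  then show ?thesis by (simp add: SB_def sinhc_def)
qed

text \<open>Both means are divided by \<open>a\<close> and the strictly increasing
  \<open>box_cox p\<close> is applied.\<close>

lemma M_SB_iff:
  assumes "(p, q) \<in> Omega" "0 < a" "a < b"
  defines "x \<equiv> arcosh (b / a)"
  shows "M p q a b < SB b a \<longleftrightarrow> box_cox q (cosh x) < 3 * box_cox p (sinhc x)"
    and "SB b a < M p q a b \<longleftrightarrow> 3 * box_cox p (sinhc x) < box_cox q (cosh x)"
proof -
  have x: "x > 0" "cosh x = b / a" using assms by (auto simp: x_def)
  have S: "sinhc x > 0" using sinhc_gt_1[OF x(1)] by simp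
  have "SB b a = a * sinhc x" using assms by (simp add: SB_eq)
  then have "M p q a b < SB b a \<longleftrightarrow> M p q a b / a < sinhc x"
    "SB b a < M p q a b \<longleftrightarrow> sinhc x < M p q a b / a"
    using assms by (simp_all add: field_simps)
  then show "M p q a b < SB b a \<longleftrightarrow> box_cox q (cosh x) < 3 * box_cox p (sinhc x)"
    and "SB b a < M p q a b \<longleftrightarrow> 3 * box_cox p (sinhc x) < box_cox q (cosh x)"
    using box_cox_less_iff[OF box_cox_M(1)[OF assms(1-3)] S, of p]
      box_cox_less_iff[OF S box_cox_M(1)[OF assms(1-3)], of p]
    by (auto simp: box_cox_M(2)[OF assms(1-3)] x(2))
qed

definition lower :: "real \<Rightarrow> real \<Rightarrow> bool" where
  "lower p q \<longleftrightarrow> (\<forall>x>0. box_cox q (cosh x) < 3 * box_cox p (sinhc x))"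

definition upper :: "real \<Rightarrow> real \<Rightarrow> bool" where
  "upper p q \<longleftrightarrow> (\<forall>x>0. 3 * box_cox p (sinhc x) < box_cox q (cosh x))"

lemma lower_iff:
  assumes "(p, q) \<in> Omega"
  shows "(\<forall>a b. 0 < a \<and> a < b \<longrightarrow> M p q a b < SB b a) \<longleftrightarrow> lower p q"
proof (intro iffI allI impI)
  assume L: "\<forall>a b. 0 < a \<and> a < b \<longrightarrow> M p q a b < SB b a"
  show "lower p q"
    unfolding lower_def
  proof (intro allI impI)
    fix x :: real assume "x > 0"
    \<comment> \<open>The pair \<open>a = 1\<close>, \<open>b = cosh x\<close> realises the given
      \<open>x\<close>.\<close>
    then show "box_cox q (cosh x) < 3 * box_cox p (sinhc x)"
      using L[rule_format, of 1 "cosh x"] M_SB_iff(1)[OF assms, of 1 "cosh x"] cosh_gt_1[of x]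
      by (simp add: arcosh_cosh_real)
  qed
next
  fix a b :: real assume "lower p q" "0 < a \<and> a < b"
  then show "M p q a b < SB b a"
    using M_SB_iff(1)[OF assms, of a b] by (simp add: lower_def del: cosh_arcosh_real)
qed

lemma upper_iff:
  assumes "(p, q) \<in> Omega"
  shows "(\<forall>a b. 0 < a \<and> a < b \<longrightarrow> SB b a < M p q a b) \<longleftrightarrow> upper p q"
proof (intro iffI allI impI)
  assume L: "\<forall>a b. 0 < a \<and> a < b \<longrightarrow> SB b a < M p q a b"
  show "upper p q"
    unfolding upper_def
  proof (intro allI impI)
    fix x :: real assume "x > 0"
    then show "3 * box_cox p (sinhc x) < box_cox q (cosh x)"
      using L[rule_format, of 1 "cosh x"] M_SB_iff(2)[OF assms, of 1 "cosh x"] cosh_gt_1[of x]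
      by (simp add: arcosh_cosh_real)
  qed
next
  fix a b :: real assume "upper p q" "0 < a \<and> a < b"
  then show "SB b a < M p q a b"
    using M_SB_iff(2)[OF assms, of a b] by (simp add: upper_def del: cosh_arcosh_real)
qed

text \<open>Since \<open>cosh x \<ge> 1\<close>, sufficiency has to be proved only at the extreme
  \<open>q\<close> for each \<open>p\<close>.\<close>

lemma lower_antimono: "lower p q \<Longrightarrow> q' \<le> q \<Longrightarrow> lower p q'"
  unfolding lower_def using box_cox_mono_exponent[OF _ cosh_real_ge_1, of q' q] by (meson le_less_trans)

lemma upper_mono: "upper p q \<Longrightarrow> q \<le> q' \<Longrightarrow> upper p q'"
  unfolding upper_def using box_cox_mono_exponent[OF _ cosh_real_ge_1, of q q'] by (meson less_le_trans)

subsection \<open>Monotonicity along lines of parameters\<close>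

lemma weighted_power_mean:
  fixes k w z :: real
  assumes "k \<ge> 1" "0 \<le> w" "w \<le> 1" "z > 0"
  shows "((1 - w) + w * z) powr k \<le> (1 - w) + w * z powr k"
  using convex_onD[OF powr_convex[OF assms(1)], of w 1 z] assms by simp

text \<open>The case \<open>4/5\<close>, with weight 1/3, is raised to a power
  \<open>k \<ge> 1\<close>; convexity keeps the weight.\<close>

lemma upper_diagonal:
  assumes "p \<ge> 4/5" shows "upper p p"
  unfolding upper_def
proof (intro allI impI)
  fix x :: real assume x: "x > 0"
  note S = sinhc_gt_1[OF x] and C = cosh_gt_1[OF x]
  define k where "k = p / (4/5)"
  have k: "k \<ge> 1" "4/5 * k = p" using assms by (auto simp: k_def)
  have "sinhc x powr p = (sinhc x powr (4/5)) powr k"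
    by (simp add: powr_powr k_def)
  also have "\<dots> < (2/3 + 1/3 * cosh x powr (4/5)) powr k"
    using gap_45[OF x] S k by (intro powr_less_mono2) (auto simp: box_cox_def field_simps)
  also have "\<dots> \<le> 2/3 + 1/3 * (cosh x powr (4/5)) powr k"
    using weighted_power_mean[OF k(1), of "1/3" "cosh x powr (4/5)"] by simp
  also have "(cosh x powr (4/5)) powr k = cosh x powr p"
    by (simp add: powr_powr k_def)
  finally have "(sinhc x powr p - 1) / p < ((2/3 + 1/3 * cosh x powr p) - 1) / p"
    using assms by (intro divide_strict_right_mono) auto
  then show "3 * box_cox p (sinhc x) < box_cox p (cosh x)"
    using assms by (simp add: box_cox_def diff_divide_distrib add_divide_distrib)
qed

lemma sinhc_powr_lower_bound:
  assumes "x > 0"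
  shows "28/51 + 23/51 * cosh x powr (34/35) < sinhc x powr (46/35)"
  using gap_46_35[OF assms] by (simp add: box_cox_def field_simps)

text \<open>The weight \<open>p / (3 * q)\<close> is 23/51 all along the ray. Convexity with
  exponent \<open>k\<close> leads from \<open>p\<close> to \<open>46/35\<close>, and a
  \<open>k\<close>-th root leads back.\<close>

lemma lower_ray:
  assumes "0 < p" "p \<le> 46/35" shows "lower p (17 * p / 23)"
  unfolding lower_def
proof (intro allI impI)
  fix x :: real assume x: "x > 0"
  note S = sinhc_gt_1[OF x] and C = cosh_gt_1[OF x]
  define q where "q = 17 * p / 23"
  define k where "k = 46/35 / p"
  have k: "k \<ge> 1" "p * k = 46/35" "q * k = 34/35" using assms by (auto simp: k_def q_def)
  have "(28/51 + 23/51 * cosh x powr q) powr k \<le> 28/51 + 23/51 * (cosh x powr q) powr k"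
    using weighted_power_mean[OF k(1), of "23/51" "cosh x powr q"] by simp
  also have "\<dots> < (sinhc x powr p) powr k"
    using sinhc_powr_lower_bound[OF x] by (simp add: powr_powr k)
  finally have "28/51 + 23/51 * cosh x powr q < sinhc x powr p"
    using powr_mono2[of k "sinhc x powr p" "28/51 + 23/51 * cosh x powr q"] k by force
  then have "((28/51 + 23/51 * cosh x powr q) - 1) / p < (sinhc x powr p - 1) / p"
    using assms by (intro divide_strict_right_mono) auto
  then have "box_cox q (cosh x) / 3 < box_cox p (sinhc x)"
    using assms by (simp add: box_cox_def q_def diff_divide_distrib add_divide_distrib)
  then show "box_cox (17 * p / 23) (cosh x) < 3 * box_cox p (sinhc x)"
    by (simp add: q_def)
qed

text \<open>At the end of the ray the power mean becomes a geometric one, so convexity of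
  \<open>exp\<close> takes over; \<open>23/51 * 34/35\<close> is a third of
  \<open>46/35\<close>.\<close>

lemma lower_0_0: "lower 0 0"
  unfolding lower_def
proof (intro allI impI)
  fix x :: real assume x: "x > 0"
  note S = sinhc_gt_1[OF x] and C = cosh_gt_1[OF x]
  define y where "y = 34/35 * ln (cosh x)"
  have "exp (23/51 * y) \<le> 28/51 + 23/51 * exp y"
    using convex_onD[OF exp_convex, of "23/51" 0 y] by simp
  also have "exp y = cosh x powr (34/35)"
    using C by (simp add: powr_def y_def)
  also have "28/51 + 23/51 * cosh x powr (34/35) < sinhc x powr (46/35)"
    by (rule sinhc_powr_lower_bound[OF x])
  also have "\<dots> = exp (46/35 * ln (sinhc x))"
    using S by (simp add: powr_def)
  finally show "box_cox 0 (cosh x) < 3 * box_cox 0 (sinhc x)"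
    by (simp add: box_cox_def y_def)
qed

text \<open>
  Three times the logarithm of the mean with parameters \<open>(3 * r, r + c)\<close> at \<open>a = 1\<close>, \<open>b = t\<close>. Its
  derivative in \<open>t\<close> can be written with \<open>box_cox\<close> at the exponent \<open>- (r + c)\<close>, which makes the
  monotonicity in \<open>r\<close> visible.
\<close>
definition line_mean :: "real \<Rightarrow> real \<Rightarrow> real \<Rightarrow> real" where
  "line_mean c r t = (if r = 0 then box_cox c t else ln (1 + r * box_cox (r + c) t) / r)"

text \<open>With \<open>p = 3 * r\<close> the factor 3 cancels, and for \<open>r > 0\<close> both
  inequalities compare \<open>B\<close> with \<open>s powr (3 * r)\<close>; logarithms are then
  divided by \<open>r\<close>.\<close>

lemma line_mean_iff:
  assumes "c > 0" "r \<ge> 0" "t > 1" "s > 0"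
  shows "box_cox (r + c) t < 3 * box_cox (3 * r) s \<longleftrightarrow> line_mean c r t < 3 * ln s"
    and "3 * box_cox (3 * r) s < box_cox (r + c) t \<longleftrightarrow> 3 * ln s < line_mean c r t"
proof -
  have "(box_cox (r + c) t < 3 * box_cox (3 * r) s \<longleftrightarrow> line_mean c r t < 3 * ln s) \<and>
    (3 * box_cox (3 * r) s < box_cox (r + c) t \<longleftrightarrow> 3 * ln s < line_mean c r t)"
  proof (cases "r = 0")
    case True
    then show ?thesis by (simp add: line_mean_def box_cox_def[of 0])
  next
    case False
    define B where "B = 1 + r * box_cox (r + c) t"
    have "box_cox (r + c) t > 0" using box_cox_strict_mono[of 1 t "r + c"] assms by simp
    then have B: "B > 0" using assms by (simp add: B_def add_pos_nonneg)
    have "box_cox (r + c) t = (B - 1) / r" using False by (simp add: B_def)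
    moreover have "3 * box_cox (3 * r) s = (s powr (3 * r) - 1) / r"
      using False by (simp add: box_cox_def field_simps)
    moreover have "B < s powr (3*r) \<longleftrightarrow> ln B < 3 * r * ln s" "s powr (3*r) < B \<longleftrightarrow> 3 * r * ln s < ln B"
      using B assms ln_less_cancel_iff[of B "s powr (3*r)"] ln_less_cancel_iff[of "s powr (3*r)" B]
      by (simp_all add: ln_powr)
    moreover have "line_mean c r t = ln B / r"
      using False by (simp add: line_mean_def B_def)
    ultimately show ?thesis
      using False assms by (simp add: divide_less_cancel pos_divide_less_eq pos_less_divide_eq mult_ac)
  qed
  then show "box_cox (r + c) t < 3 * box_cox (3 * r) s \<longleftrightarrow> line_mean c r t < 3 * ln s"
    and "3 * box_cox (3 * r) s < box_cox (r + c) t \<longleftrightarrow> 3 * ln s < line_mean c r t"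
    by auto
qed

lemma line_mean_has_derivative:
  assumes "c > 0" "r \<ge> 0" "t \<ge> 1"
  shows "1 - c * box_cox (- (r + c)) t > 0"
    and "(line_mean c r has_real_derivative 1 / (t * (1 - c * box_cox (- (r + c)) t))) (at t)"
proof -
  define D where "D = 1 - c * box_cox (- (r + c)) t"
  have nn: "box_cox (r + c) t \<ge> 0" using box_cox_mono_exponent[of 0 "r + c" t] assms
    by (simp add: box_cox_def[of 0]) (meson ln_ge_zero order_trans)
  have pos: "1 + r * box_cox (r + c) t > 0" using nn assms by (simp add: add_pos_nonneg)
  have eq: "1 + r * box_cox (r + c) t = t powr (r + c) * D"
  proof -
    define P Q X Y where "P = t powr (r + c)" and "Q = t powr (- (r + c))"
      and "X = box_cox (r + c) t" and "Y = box_cox (- (r + c)) t"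
    have "P * Q = 1"
      using assms by (simp add: P_def Q_def flip: powr_add)
    moreover have "(r + c) * X = P - 1" "(r + c) * Y = 1 - Q"
      using assms by (simp_all add: P_def Q_def X_def Y_def box_cox_def field_simps)
    \<comment> \<open>Both sides equal \<open>r * P + c\<close>.\<close>
    ultimately have "(r + c) * (1 + r * X) = (r + c) * (P * (1 - c * Y))"
      by algebra
    then show ?thesis
      using assms by (simp add: D_def P_def X_def Y_def)
  qed
  then show D: "1 - c * box_cox (- (r + c)) t > 0"
    using pos assms by (simp add: zero_less_mult_iff D_def)
  have "(line_mean c r has_real_derivative t powr (r + c - 1) / (1 + r * box_cox (r + c) t)) (at t)"
    unfolding line_mean_def using pos assms
    by (cases "r = 0") (auto intro!: derivative_eq_intros)
  then show "(line_mean c r has_real_derivative 1 / (t * (1 - c * box_cox (- (r + c)) t))) (at t)"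
    unfolding eq using assms D by (simp add: D_def powr_diff)
qed

text \<open>Both functions vanish at \<open>t = 1\<close>, and raising \<open>r\<close> lowers the
  exponent \<open>- (r + c)\<close>, hence the derivative.\<close>

lemma line_mean_antimono:
  assumes "c > 0" "0 \<le> r" "r \<le> r'" "t \<ge> 1"
  shows "line_mean c r' t \<le> line_mean c r t"
proof -
  have "line_mean c r 1 - line_mean c r' 1 \<le> line_mean c r t - line_mean c r' t"
    using assms(4)
  proof (rule DERIV_nonneg_imp_nondecreasing)
    fix z :: real assume z: "1 \<le> z" "z \<le> t"
    have r': "r' \<ge> 0" using assms by simp
    note d = line_mean_has_derivative[OF assms(1,2) z(1)] line_mean_has_derivative[OF assms(1) r' z(1)]
    have "box_cox (- (r' + c)) z \<le> box_cox (- (r + c)) z"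
      using assms z by (intro box_cox_mono_exponent) auto
    then have "1 - c * box_cox (- (r + c)) z \<le> 1 - c * box_cox (- (r' + c)) z"
      using assms by simp
    then have "1 / (z * (1 - c * box_cox (- (r' + c)) z)) \<le> 1 / (z * (1 - c * box_cox (- (r + c)) z))"
      using d(1) z by (intro divide_left_mono mult_left_mono mult_pos_pos) auto
    then show "\<exists>D. ((\<lambda>t. line_mean c r t - line_mean c r' t) has_real_derivative D) (at z) \<and> D \<ge> 0"
      using DERIV_diff[OF d(2,4)] by force
  qed
  moreover have "line_mean c s 1 = 0" for s by (simp add: line_mean_def)
  ultimately show ?thesis by simp
qed

lemma lower_line:
  assumes "p \<ge> 46/35" shows "lower p (p/3 + 8/15)"
  unfolding lower_def
proof (intro allI impI)
  fix x :: real assume x: "x > 0"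
  note S = sinhc_gt_1[OF x] and C = cosh_gt_1[OF x]
  have "line_mean (8/15) (p/3) (cosh x) \<le> line_mean (8/15) (46/105) (cosh x)"
    using assms C by (intro line_mean_antimono) auto
  also have "\<dots> < 3 * ln (sinhc x)"
    using gap_46_35[OF x] line_mean_iff(1)[of "8/15" "46/105" "cosh x" "sinhc x"] S C by simp
  finally show "box_cox (p/3 + 8/15) (cosh x) < 3 * box_cox p (sinhc x)"
    using line_mean_iff(1)[of "8/15" "p/3" "cosh x" "sinhc x"] S C assms by simp
qed

text \<open>Now \<open>p/3\<close> lies below \<open>4/15\<close>, so the antitone
  \<open>line_mean\<close> transports the upper bound from \<open>p = 4/5\<close>.\<close>

lemma upper_line:
  assumes "0 \<le> p" "p \<le> 4/5" shows "upper p (p/3 + 8/15)"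
  unfolding upper_def
proof (intro allI impI)
  fix x :: real assume x: "x > 0"
  note S = sinhc_gt_1[OF x] and C = cosh_gt_1[OF x]
  have "3 * ln (sinhc x) < line_mean (8/15) (4/15) (cosh x)"
    using gap_45[OF x] line_mean_iff(2)[of "8/15" "4/15" "cosh x" "sinhc x"] S C by simp
  also have "\<dots> \<le> line_mean (8/15) (p/3) (cosh x)"
    using assms C by (intro line_mean_antimono) auto
  finally show "3 * box_cox p (sinhc x) < box_cox (p/3 + 8/15) (cosh x)"
    using line_mean_iff(2)[of "8/15" "p/3" "cosh x" "sinhc x"] S C assms by simp
qed

subsection \<open>Necessity\<close>

lemma box_cox_second_order:
  fixes f :: "real \<Rightarrow> real"
  assumes f: "(f \<longlongrightarrow> 0) (at_right 0)" "\<And>x. x > 0 \<Longrightarrow> f x > 0"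
  shows "((\<lambda>x. (box_cox p (exp (f x)) - f x) / (f x)\<^sup>2) \<longlongrightarrow> p / 2) (at_right 0)"
proof -
  have "((\<lambda>v. (box_cox p (exp v) - v) / v\<^sup>2) \<longlongrightarrow> p / 2) (at_right (0::real))"
  proof (cases "p = 0")
    case False
    have "((\<lambda>v. ((exp (p * v) - 1) / p - v) / v\<^sup>2) \<longlongrightarrow> p / 2) (at_right (0::real))"
      using False by real_asymp
    then show ?thesis using False by (simp add: box_cox_def powr_def)
  qed (simp add: box_cox_def)
  moreover have "filterlim f (at_right 0) (at_right 0)"
    using f eventually_mono[OF eventually_at_right_less[of "0::real"], of "\<lambda>x. f x \<in> {0<..} \<and> f x \<noteq> 0"]
    by (force simp: filterlim_at)
  ultimately show ?thesis by (rule filterlim_compose)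
qed

text \<open>The quadratic remainders of the two transforms contribute \<open>p / 24\<close> and
  \<open>- q / 8\<close>, and \<open>3 * v x - u x\<close> contributes 1/15.\<close>

lemma gap_limit:
  "((\<lambda>x. (3 * box_cox p (sinhc x) - box_cox q (cosh x)) / x ^ 4) \<longlongrightarrow> (p/3 + 8/15 - q) / 8) (at_right 0)"
proof -
  define v u where "v x = ln (sinhc x)" and "u x = ln (cosh x)" for x :: real
  have pos: "v x > 0" "u x > 0" if "x > 0" for x
    using sinhc_gt_1[OF that] cosh_gt_1[OF that] by (auto simp: v_def u_def)
  have "((\<lambda>x. ln (sinh x / x)) \<longlongrightarrow> 0) (at_right (0::real))" "(u \<longlongrightarrow> 0) (at_right 0)"
    unfolding u_def by real_asymp+
  then have second: "((\<lambda>x. (box_cox p (exp (v x)) - v x) / (v x)\<^sup>2) \<longlongrightarrow> p / 2) (at_right 0)"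
    "((\<lambda>x. (box_cox q (exp (u x)) - u x) / (u x)\<^sup>2) \<longlongrightarrow> q / 2) (at_right 0)"
    using pos by (auto intro!: box_cox_second_order simp: v_def sinhc_def)
  have sq: "((\<lambda>x. v x / x\<^sup>2) \<longlongrightarrow> 1/6) (at_right 0)" "((\<lambda>x. u x / x\<^sup>2) \<longlongrightarrow> 1/2) (at_right 0)"
    and fourth: "((\<lambda>x. (3 * v x - u x) / x ^ 4) \<longlongrightarrow> 1/15) (at_right 0)"
    unfolding v_def u_def sinhc_def by real_asymp+
  have lim: "((\<lambda>x. 3 * ((box_cox p (exp (v x)) - v x) / (v x)\<^sup>2 * (v x / x\<^sup>2)\<^sup>2)
      - (box_cox q (exp (u x)) - u x) / (u x)\<^sup>2 * (u x / x\<^sup>2)\<^sup>2 + (3 * v x - u x) / x ^ 4)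
    \<longlongrightarrow> 3 * (p / 2 * (1/6)\<^sup>2) - q / 2 * (1/2)\<^sup>2 + 1/15) (at_right 0)"
    by (intro tendsto_intros second sq fourth)
  have eq: "3 * (p / 2 * (1/6)\<^sup>2) - q / 2 * (1/2)\<^sup>2 + 1/15 = (p/3 + 8/15 - q) / 8"
    by (simp add: power2_eq_square)
  have ev: "eventually (\<lambda>x. 3 * ((box_cox p (exp (v x)) - v x) / (v x)\<^sup>2 * (v x / x\<^sup>2)\<^sup>2)
      - (box_cox q (exp (u x)) - u x) / (u x)\<^sup>2 * (u x / x\<^sup>2)\<^sup>2 + (3 * v x - u x) / x ^ 4
    = (3 * box_cox p (sinhc x) - box_cox q (cosh x)) / x ^ 4) (at_right 0)"
    using eventually_at_right_less
  proof eventually_elim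
    case (elim x)
    have "exp (v x) = sinhc x" "exp (u x) = cosh x"
      using sinhc_gt_1[OF elim] by (auto simp: v_def u_def)
    then show ?case
    proof -
      have "(A - w) / w\<^sup>2 * (w / x\<^sup>2)\<^sup>2 = (A - w) / x ^ 4" if "w > 0" for A w :: real
        using that elim by (simp add: power_divide flip: power_mult)
      then show ?thesis
        unfolding \<open>exp (v x) = _\<close> \<open>exp (u x) = _\<close> using pos[OF elim]
        by (simp add: diff_divide_distrib)
    qed
  qed
  show ?thesis using Lim_transform_eventually[OF lim ev] unfolding eq .
qed

lemma lower_imp_le:
  assumes "lower p q" shows "q \<le> p/3 + 8/15"
proof -
  have "(p/3 + 8/15 - q) / 8 \<ge> 0"
  proof (rule tendsto_lowerbound[OF gap_limit])
    show "\<forall>\<^sub>F x in at_right 0. 0 \<le> (3 * box_cox p (sinhc x) - box_cox q (cosh x)) / x ^ 4"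
      using eventually_at_right_less by eventually_elim (use assms in \<open>auto simp: lower_def less_imp_le\<close>)
  qed simp
  then show ?thesis by simp
qed

lemma upper_imp_ge:
  assumes "upper p q" shows "q \<ge> p/3 + 8/15"
proof -
  have "(p/3 + 8/15 - q) / 8 \<le> 0"
  proof (rule tendsto_upperbound[OF gap_limit])
    show "\<forall>\<^sub>F x in at_right 0. (3 * box_cox p (sinhc x) - box_cox q (cosh x)) / x ^ 4 \<le> 0"
      using eventually_at_right_less
      by eventually_elim (use assms in \<open>auto simp: upper_def less_imp_le divide_nonpos_pos\<close>)
  qed simp
  then show ?thesis by simp
qed

section \<open>Necessity from the growth at infinity\<close>

lemma upper_imp_ge_diagonal:
  assumes "p > 0" "upper p q" shows "q \<ge> p"
proof (rule ccontr)
  assume "\<not> q \<ge> p"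
  \<comment> \<open>Raising \<open>q\<close> to a positive exponent still below \<open>p\<close>
    preserves \<open>upper\<close>; then \<open>sinhc x powr p\<close> outgrows
    \<open>cosh x powr r\<close> despite the division by a power of \<open>x\<close>.\<close>
  define r where "r = max q (p/2)"
  have r: "0 < r" "r < p" "q \<le> r" using assms \<open>\<not> q \<ge> p\<close> by (auto simp: r_def)
  have "filterlim (\<lambda>x. 3 * ((sinh x / x) powr p - 1) / p - (cosh x powr r - 1) / r) at_top at_top"
    using assms r by real_asymp
  then have "eventually (\<lambda>x. 3 * ((sinh x / x) powr p - 1) / p - (cosh x powr r - 1) / r > 0) at_top"
    unfolding filterlim_at_top_dense by (rule spec)
  with eventually_gt_at_top[of 0] have "eventually (\<lambda>x::real. False) at_top"
  proof eventually_elim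
    case (elim x)
    moreover have "3 * box_cox p (sinhc x) < box_cox r (cosh x)"
      using upper_mono[OF assms(2) r(3)] elim(1) by (simp add: upper_def)
    ultimately show ?case using assms r by (simp add: box_cox_def sinhc_def)
  qed
  then show False by simp
qed

text \<open>For \<open>q > 0\<close> the left side grows exponentially, while
  \<open>ln (sinhc x)\<close> grows only linearly.\<close>

lemma lower_0_imp_le:
  assumes "lower 0 q" shows "q \<le> 0"
proof (rule ccontr)
  assume "\<not> q \<le> 0"
  then have q: "q > 0" by simp
  then have "filterlim (\<lambda>x. (cosh x powr q - 1) / q - 3 * ln (sinh x / x)) at_top at_top"
    by real_asymp
  then have "eventually (\<lambda>x. (cosh x powr q - 1) / q - 3 * ln (sinh x / x) > 0) at_top"
    unfolding filterlim_at_top_dense by (rule spec)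
  with eventually_gt_at_top[of 0] have "eventually (\<lambda>x::real. False) at_top"
    by eventually_elim (use assms q in \<open>fastforce simp: lower_def box_cox_def sinhc_def\<close>)
  then show False by simp
qed

theorem theorem7:
  fixes p q1 q2 :: real
  assumes "(p, q1) \<in> Omega" and "(p, q2) \<in> Omega"
  shows
    "(p \<in> {46/35..} \<longrightarrow>
        ((\<forall>a b. 0 < a \<and> a < b \<longrightarrow> M p q1 a b < SB b a \<and> SB b a < M p q2 a b)
           \<longleftrightarrow> q1 \<le> p / 3 + 8 / 15 \<and> q2 \<ge> p))
   \<and> (p \<in> {4/5..<46/35} \<longrightarrow>
        (q1 \<le> 17 * p / 23 \<longrightarrow> (\<forall>a b. 0 < a \<and> a < b \<longrightarrow> M p q1 a b < SB b a))
      \<and> ((\<forall>a b. 0 < a \<and> a < b \<longrightarrow> SB b a < M p q2 a b) \<longleftrightarrow> q2 \<ge> p))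
   \<and> (p \<in> {0<..<4/5} \<longrightarrow>
        (q1 \<le> 17 * p / 23 \<longrightarrow> (\<forall>a b. 0 < a \<and> a < b \<longrightarrow> M p q1 a b < SB b a))
      \<and> ((\<forall>a b. 0 < a \<and> a < b \<longrightarrow> SB b a < M p q2 a b) \<longleftrightarrow> q2 \<ge> p / 3 + 8 / 15))
   \<and> (p \<in> {..0} \<longrightarrow>
        ((\<forall>a b. 0 < a \<and> a < b \<longrightarrow> M p q1 a b < SB b a \<and> SB b a < M p q2 a b)
           \<longleftrightarrow> q1 \<le> p \<and> q2 \<ge> p / 3 + 8 / 15))"
proof -
  have both: "(\<forall>a b. 0 < a \<and> a < b \<longrightarrow> M p q1 a b < SB b a \<and> SB b a < M p q2 a b)
      \<longleftrightarrow> lower p q1 \<and> upper p q2"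
    using lower_iff[OF assms(1)] upper_iff[OF assms(2)] by blast
  \<comment> \<open>The bounds \<open>p\<close> and \<open>p/3 + 8/15\<close> for \<open>q2\<close>
    coincide at \<open>p = 4/5\<close>; above it the diagonal is the stronger one, below it the
    line.\<close>
  have diagonal: "upper p q2 \<longleftrightarrow> q2 \<ge> p" if "p \<ge> 4/5"
    using that upper_imp_ge_diagonal[of p q2] upper_diagonal[of p] upper_mono by auto
  have line: "lower p q1 \<longleftrightarrow> q1 \<le> p/3 + 8/15" if "p \<ge> 46/35"
    using that lower_imp_le lower_line lower_antimono by blast
  have line': "upper p q2 \<longleftrightarrow> q2 \<ge> p/3 + 8/15" if "0 \<le> p" "p \<le> 4/5"
    using that upper_imp_ge upper_line upper_mono by blast
  have ray: "lower p q1" if "0 < p" "p \<le> 46/35" "q1 \<le> 17 * p / 23"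
    using that lower_ray lower_antimono by blast
  have zero: "lower p q1 \<longleftrightarrow> q1 \<le> p" if "p = 0"
    using that lower_0_imp_le lower_0_0 lower_antimono by blast
  \<comment> \<open>For \<open>p < 0\<close> membership in \<open>Omega\<close> forces \<open>q2 \<le> p / 3\<close>, so both sides of (iv) are false.\<close>
  have negative: "\<not> upper p q2 \<and> \<not> q2 \<ge> p/3 + 8/15" if "p < 0"
  proof -
    have "q2 < p/3 + 8/15" using that assms(2) by (auto simp: Omega_def)
    then show ?thesis using upper_imp_ge[of p q2] by auto
  qed
  show ?thesis
    unfolding both lower_iff[OF assms(1)] upper_iff[OF assms(2)]
    using diagonal line line' ray zero negative by (cases "p < 0"; cases "p = 0") auto
qed

end
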